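(* The two indices $\mu_{RS}$ and $\mu'_{RS}$ defined on continuous paths of symplectic matrices do not coincide in general: there exist $n\ge1$ and a continuous path $\psi:[0,1]\to\mathrm{Sp}(\mathbb{R}^{2n},\Omega_0)$ such that $\mu_{RS}(\psi)\neq\mu'_{RS}(\psi)$.
   Context: Notation. $\Omega_0=\begin{pmatrix}0&\mathrm{Id}_n\\-\mathrm{Id}_n&0\end{pmatrix}$, $\Omega_0(v,w)=v^\tau\Omega_0w$, on $\mathbb{R}^{2n}$; $\mathrm{Sp}(\mathbb{R}^{2n},\Omega_0)$ is the group of symplectic $2n\times2n$ matrices. The signature $\mathrm{Sign}$ of a symmetric form is the number of positive minus the number of negative eigenvalues. Robbin-Salamon index of a path of Lagrangians. Let $(W,\Omega)$ be a finite-dimensional real symplectic vector space and $L\subset W$ a fixed Lagrangian subspace. For a smooth path $\Lambda:[a,b]\to\mathcal{L}_{(W,\Omega)}$ in the space of Lagrangian subspaces and $t_0\in[a,b]$, choose a Lagrangian $M$ with $\Lambda_{t_0}\oplus M=W$; for $t$ near $t_0$ write $\Lambda_t=\{v+\alpha_t(v)\mid v\in\Lambda_{t_0}\}$ with $\alpha_t:\Lambda_{t_0}\to M$ linear, and let $Q(\Lambda_{t_0},\dot\Lambda_{t_0})(v,v')=\frac{d}{dt}\Omega(v,\alpha_t(v'))|_{t=t_0}$, a symmetric bilinear form on $\Lambda_{t_0}$ independent of $M$. A crossing is a $t$ with $\Lambda_t\cap L\ne\{0\}$; its crossing form is $\Gamma(\Lambda,L,t)=Q(\Lambda_t,\dot\Lambda_t)|_{\Lambda_t\cap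 L}$; it is regular if this form is nondegenerate. For a path with only regular crossings, $$\mu_{RS}(\Lambda,L)=\tfrac12\mathrm{Sign}\,\Gamma(\Lambda,L,a)+\sum_{a<t<b,\ t\text{ crossing}}\mathrm{Sign}\,\Gamma(\Lambda,L,t)+\tfrac12\mathrm{Sign}\,\Gamma(\Lambda,L,b).$$ Every continuous path of Lagrangians is homotopic with fixed end points to one with only regular crossings, and two paths with only regular crossings homotopic with fixed end points have the same index; this defines $\mu_{RS}(\Lambda,L)$ for every continuous path. The index $\mu_{RS}$ on symplectic paths. For a continuous $\psi:[a,b]\to\mathrm{Sp}(\mathbb{R}^{2n},\Omega_0)$, $\mu_{RS}(\psi):=\mu_{RS}(\mathrm{Gr}\,\psi,\Delta)$, where $\mathrm{Gr}\,\psi_t=\{(x,\psi_tx)\mid x\in\mathbb{R}^{2n}\}$ and $\Delta=\{(x,x)\mid x\in\mathbb{R}^{2n}\}$ are Lagrangians in $(\mathbb{R}^{2n}\times\mathbb{R}^{2n},\overline\Omega=-\Omega_0\times\Omega_0)$. The index $\mu'_{RS}$ on symplectic paths. With the fixed Lagrangian $L=\{0\}\times\mathbb{R}^n$ in $(\mathbb{R}^{2n},\Omega_0)$, $\mu'_{RS}(\psi):=\mu_{RS}(\psi L,L)$, the index of the path of Lagrangians $t\mapsto\psi_tL$ with reference Lagrangian $L$. *)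

theory Defs
  imports "HOL-Analysis.Analysis" "HOL-Analysis.Finite_Function_Topology"
begin

section \<open>Symmetric bilinear forms on a finite-dimensional subspace\<close>

text \<open>The eigenvalues of a form are those of its Gram matrix in a basis, i.e. its eigenvalues
  relative to the inner product that makes this basis orthonormal. By Sylvester's law of inertia
  the signature does not depend on the basis.\<close>

definition basis_inner :: "'a::real_vector set \<Rightarrow> 'a \<Rightarrow> 'a \<Rightarrow> real" where
  "basis_inner E v w = (\<Sum>e\<in>E. representation E v e * representation E w e)"

definition form_eigenspace ::
  "'a::real_vector set \<Rightarrow> 'a set \<Rightarrow> ('a \<Rightarrow> 'a \<Rightarrow> real) \<Rightarrow> real \<Rightarrow> 'a set" where
  "form_eigenspace E V B l = {v \<in> V. \<forall>w\<in>V. B v w = l * basis_inner E v w}"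

definition form_eigenvalues ::
  "'a::real_vector set \<Rightarrow> 'a set \<Rightarrow> ('a \<Rightarrow> 'a \<Rightarrow> real) \<Rightarrow> real set" where
  "form_eigenvalues E V B = {l. form_eigenspace E V B l \<noteq> {0}}"

definition signature :: "'a::real_vector set \<Rightarrow> ('a \<Rightarrow> 'a \<Rightarrow> real) \<Rightarrow> int" where
  "signature V B =
    (let E = (SOME E. finite E \<and> independent E \<and> span E = V)
     in (\<Sum>l | l \<in> form_eigenvalues E V B \<and> l > 0. int (dim (form_eigenspace E V B l)))
      - (\<Sum>l | l \<in> form_eigenvalues E V B \<and> l < 0. int (dim (form_eigenspace E V B l))))"

definition nondegenerate_on :: "'a::real_vector set \<Rightarrow> ('a \<Rightarrow> 'a \<Rightarrow> real) \<Rightarrow> bool" where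
  "nondegenerate_on V B \<longleftrightarrow> (\<forall>v\<in>V. (\<forall>w\<in>V. B v w = 0) \<longrightarrow> v = 0)"


section \<open>The space of Lagrangian subspaces\<close>

text \<open>Throughout, a symplectic vector space is given by a finite-dimensional subspace \<open>W\<close> of a
  real normed space together with a form \<open>\<Omega>\<close> that is symplectic on \<open>W\<close>. The ambient type only
  serves to let the dimension of \<open>W\<close> vary; on \<open>W\<close> all norms are equivalent.\<close>

definition lagrangian :: "'a::real_vector set \<Rightarrow> ('a \<Rightarrow> 'a \<Rightarrow> real) \<Rightarrow> 'a set \<Rightarrow> bool" where
  "lagrangian W \<Omega> V \<longleftrightarrow> subspace V \<and> V \<subseteq> W \<and> {w \<in> W. \<forall>v\<in>V. \<Omega> v w = 0} = V"

definition lagrangian_frames ::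
  "'a::real_vector set \<Rightarrow> ('a \<Rightarrow> 'a \<Rightarrow> real) \<Rightarrow> nat \<Rightarrow> (nat \<Rightarrow> 'a) set" where
  "lagrangian_frames W \<Omega> k =
    {f. (\<forall>i\<ge>k. f i = 0) \<and> inj_on f {..<k} \<and> independent (f ` {..<k})
        \<and> lagrangian W \<Omega> (span (f ` {..<k}))}"

text \<open>The topology of the Lagrangian Grassmannian: the quotient topology of the space of frames
  (ordered bases) of Lagrangian subspaces, under the map sending a frame to its span. Only
  \<open>k = dim W / 2\<close> contributes, as there are no other Lagrangian frames.\<close>

definition openin_lagrangians ::
  "'a::real_normed_vector set \<Rightarrow> ('a \<Rightarrow> 'a \<Rightarrow> real) \<Rightarrow> 'a set set \<Rightarrow> bool" where
  "openin_lagrangians W \<Omega> U \<longleftrightarrow>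
    U \<subseteq> Collect (lagrangian W \<Omega>) \<and>
    (\<forall>k. openin (top_of_set (lagrangian_frames W \<Omega> k))
           {f \<in> lagrangian_frames W \<Omega> k. span (f ` {..<k}) \<in> U})"

definition lagrangian_topology ::
  "'a::real_normed_vector set \<Rightarrow> ('a \<Rightarrow> 'a \<Rightarrow> real) \<Rightarrow> 'a set topology" where
  "lagrangian_topology W \<Omega> = topology (openin_lagrangians W \<Omega>)"

lemma istopology_openin_lagrangians: "istopology (openin_lagrangians W \<Omega>)"
  unfolding istopology_def
proof (intro conjI allI impI)
  fix S T assume S: "openin_lagrangians W \<Omega> S" and T: "openin_lagrangians W \<Omega> T"
  have eq: "{f \<in> lagrangian_frames W \<Omega> k. span (f ` {..<k}) \<in> S \<inter> T} =
      {f \<in> lagrangian_frames W \<Omega> k. span (f ` {..<k}) \<in> S} \<inter>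
      {f \<in> lagrangian_frames W \<Omega> k. span (f ` {..<k}) \<in> T}" for k
    by blast
  show "openin_lagrangians W \<Omega> (S \<inter> T)"
    using S T unfolding openin_lagrangians_def eq by (blast intro: openin_Int)
next
  fix K assume K: "\<forall>S\<in>K. openin_lagrangians W \<Omega> S"
  have eq: "{f \<in> lagrangian_frames W \<Omega> k. span (f ` {..<k}) \<in> \<Union>K} =
      (\<Union>S\<in>K. {f \<in> lagrangian_frames W \<Omega> k. span (f ` {..<k}) \<in> S})" for k
    by blast
  show "openin_lagrangians W \<Omega> (\<Union>K)"
    using K unfolding openin_lagrangians_def eq by (blast intro: openin_Union)
qed

lemma openin_lagrangian_topology:
  "openin (lagrangian_topology W \<Omega>) U \<longleftrightarrow> openin_lagrangians W \<Omega> U"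
  by (simp add: lagrangian_topology_def topology_inverse' istopology_openin_lagrangians)

lemma topspace_lagrangian_topology:
  "topspace (lagrangian_topology W \<Omega>) = Collect (lagrangian W \<Omega>)"
proof -
  have "{f \<in> lagrangian_frames W \<Omega> k. span (f ` {..<k}) \<in> Collect (lagrangian W \<Omega>)} =
      lagrangian_frames W \<Omega> k" for k
    by (auto simp: lagrangian_frames_def)
  then have "openin (lagrangian_topology W \<Omega>) (Collect (lagrangian W \<Omega>))"
    unfolding openin_lagrangian_topology openin_lagrangians_def by simp
  moreover have "U \<subseteq> Collect (lagrangian W \<Omega>)" if "openin (lagrangian_topology W \<Omega>) U" for U
    using that unfolding openin_lagrangian_topology openin_lagrangians_def by blast
  ultimately show ?thesis
    by (meson openin_subset openin_topspace subset_antisym)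
qed


section \<open>The Robbin-Salamon index of a path of Lagrangians\<close>

definition smooth_on :: "real set \<Rightarrow> (real \<Rightarrow> 'a::real_normed_vector) \<Rightarrow> bool" where
  "smooth_on S f \<longleftrightarrow>
    (\<exists>D. (\<forall>t\<in>S. D (0::nat) t = f t) \<and>
         (\<forall>k. \<forall>t\<in>S. (D k has_vector_derivative D (Suc k) t) (at t within S)))"

definition direct_sum :: "'a::real_vector set \<Rightarrow> 'a set \<Rightarrow> 'a set \<Rightarrow> bool" where
  "direct_sum W V M \<longleftrightarrow> V \<inter> M = {0} \<and> W = {v + m | v m. v \<in> V \<and> m \<in> M}"

text \<open>\<open>M\<close> is a Lagrangian complement of \<open>\<Lambda> t0\<close>, and near \<open>t0\<close> the subspace \<open>\<Lambda> t\<close> is the graph of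
  the linear map \<open>\<alpha> t\<close> from \<open>\<Lambda> t0\<close> to \<open>M\<close>, where \<open>\<alpha> t\<close> depends smoothly on \<open>t\<close>: this is the
  smoothness of \<open>\<Lambda>\<close> near \<open>t0\<close>, in an affine chart of the Lagrangian Grassmannian.\<close>

definition smooth_graph_at ::
  "'a::real_normed_vector set \<Rightarrow> ('a \<Rightarrow> 'a \<Rightarrow> real) \<Rightarrow> real \<Rightarrow> real \<Rightarrow> (real \<Rightarrow> 'a set)
    \<Rightarrow> real \<Rightarrow> 'a set \<Rightarrow> (real \<Rightarrow> 'a \<Rightarrow> 'a) \<Rightarrow> bool" where
  "smooth_graph_at W \<Omega> a b \<Lambda> t0 M \<alpha> \<longleftrightarrow>
    lagrangian W \<Omega> M \<and> direct_sum W (\<Lambda> t0) M \<and>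
    (\<exists>e>0.
      (\<forall>t\<in>{a..b} \<inter> {t0 - e<..<t0 + e}.
          (\<forall>v\<in>\<Lambda> t0. \<alpha> t v \<in> M) \<and>
          (\<forall>u\<in>\<Lambda> t0. \<forall>v\<in>\<Lambda> t0. \<alpha> t (u + v) = \<alpha> t u + \<alpha> t v) \<and>
          (\<forall>c. \<forall>v\<in>\<Lambda> t0. \<alpha> t (c *\<^sub>R v) = c *\<^sub>R \<alpha> t v) \<and>
          \<Lambda> t = {v + \<alpha> t v | v. v \<in> \<Lambda> t0}) \<and>
      (\<forall>v\<in>\<Lambda> t0. smooth_on ({a..b} \<inter> {t0 - e<..<t0 + e}) (\<lambda>t. \<alpha> t v)))"

definition smooth_lagrangian_path ::
  "'a::real_normed_vector set \<Rightarrow> ('a \<Rightarrow> 'a \<Rightarrow> real) \<Rightarrow> real \<Rightarrow> real \<Rightarrow> (real \<Rightarrow> 'a set) \<Rightarrow> bool" where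
  "smooth_lagrangian_path W \<Omega> a b \<Lambda> \<longleftrightarrow>
    (\<forall>t\<in>{a..b}. lagrangian W \<Omega> (\<Lambda> t)) \<and>
    (\<forall>t0\<in>{a..b}. \<exists>M \<alpha>. smooth_graph_at W \<Omega> a b \<Lambda> t0 M \<alpha>)"

text \<open>The form \<open>Q\<close>; it does not depend on the choice of \<open>M\<close>, and \<open>M\<close> determines \<open>\<alpha>\<close> near \<open>t0\<close>.
  The derivative is one-sided at the end points.\<close>

definition velocity_form ::
  "'a::real_normed_vector set \<Rightarrow> ('a \<Rightarrow> 'a \<Rightarrow> real) \<Rightarrow> real \<Rightarrow> real \<Rightarrow> (real \<Rightarrow> 'a set)
    \<Rightarrow> real \<Rightarrow> 'a \<Rightarrow> 'a \<Rightarrow> real" where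
  "velocity_form W \<Omega> a b \<Lambda> t0 v v' =
    (let \<alpha> = (SOME \<alpha>. \<exists>M. smooth_graph_at W \<Omega> a b \<Lambda> t0 M \<alpha>)
     in vector_derivative (\<lambda>t. \<Omega> v (\<alpha> t v')) (at t0 within {a..b}))"

definition crossing :: "(real \<Rightarrow> 'a::real_vector set) \<Rightarrow> 'a set \<Rightarrow> real \<Rightarrow> bool" where
  "crossing \<Lambda> L t \<longleftrightarrow> \<Lambda> t \<inter> L \<noteq> {0}"

definition regular_crossings ::
  "'a::real_normed_vector set \<Rightarrow> ('a \<Rightarrow> 'a \<Rightarrow> real) \<Rightarrow> real \<Rightarrow> real \<Rightarrow> (real \<Rightarrow> 'a set)
    \<Rightarrow> 'a set \<Rightarrow> bool" where
  "regular_crossings W \<Omega> a b \<Lambda> L \<longleftrightarrow>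
    (\<forall>t\<in>{a..b}. crossing \<Lambda> L t \<longrightarrow> nondegenerate_on (\<Lambda> t \<inter> L) (velocity_form W \<Omega> a b \<Lambda> t))"

definition crossing_signature ::
  "'a::real_normed_vector set \<Rightarrow> ('a \<Rightarrow> 'a \<Rightarrow> real) \<Rightarrow> real \<Rightarrow> real \<Rightarrow> (real \<Rightarrow> 'a set)
    \<Rightarrow> 'a set \<Rightarrow> real \<Rightarrow> real" where
  "crossing_signature W \<Omega> a b \<Lambda> L t =
    real_of_int (signature (\<Lambda> t \<inter> L) (velocity_form W \<Omega> a b \<Lambda> t))"

text \<open>At an end point that is not a crossing, the signature below is that of the form on the zero
  space, hence \<open>0\<close>. The sum is finite since regular crossings are isolated.\<close>

definition regular_rs_index ::
  "'a::real_normed_vector set \<Rightarrow> ('a \<Rightarrow> 'a \<Rightarrow> real) \<Rightarrow> real \<Rightarrow> real \<Rightarrow> (real \<Rightarrow> 'a set)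
    \<Rightarrow> 'a set \<Rightarrow> real" where
  "regular_rs_index W \<Omega> a b \<Lambda> L =
    crossing_signature W \<Omega> a b \<Lambda> L a / 2
    + (\<Sum>t | a < t \<and> t < b \<and> crossing \<Lambda> L t. crossing_signature W \<Omega> a b \<Lambda> L t)
    + crossing_signature W \<Omega> a b \<Lambda> L b / 2"

definition homotopic_fixed_ends ::
  "'a::real_normed_vector set \<Rightarrow> ('a \<Rightarrow> 'a \<Rightarrow> real) \<Rightarrow> real \<Rightarrow> real \<Rightarrow> (real \<Rightarrow> 'a set)
    \<Rightarrow> (real \<Rightarrow> 'a set) \<Rightarrow> bool" where
  "homotopic_fixed_ends W \<Omega> a b \<Lambda> \<Lambda>' \<longleftrightarrow>
    homotopic_with (\<lambda>\<Theta>. \<Theta> a = \<Lambda> a \<and> \<Theta> b = \<Lambda> b)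
      (top_of_set {a..b}) (lagrangian_topology W \<Omega>) \<Lambda> \<Lambda>'"

text \<open>The index of a continuous path is that of any path with only regular crossings homotopic to it
  with fixed end points. Such a path exists and its index does not depend on the choice, by
  the homotopy invariance of the index.\<close>

definition rs_index ::
  "'a::real_normed_vector set \<Rightarrow> ('a \<Rightarrow> 'a \<Rightarrow> real) \<Rightarrow> real \<Rightarrow> real \<Rightarrow> (real \<Rightarrow> 'a set)
    \<Rightarrow> 'a set \<Rightarrow> real" where
  "rs_index W \<Omega> a b \<Lambda> L =
    regular_rs_index W \<Omega> a b
      (SOME \<Lambda>'. smooth_lagrangian_path W \<Omega> a b \<Lambda>' \<and> regular_crossings W \<Omega> a b \<Lambda>' L \<and>
                homotopic_fixed_ends W \<Omega> a b \<Lambda> \<Lambda>') L"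


section \<open>Symplectic matrices\<close>

text \<open>\<open>\<real>\<^sup>m\<close> is the space of finitely supported sequences vanishing from index \<open>m\<close> on, so that \<open>m\<close>
  can be quantified over. An \<open>m \<times> m\<close> matrix is a function of two indices vanishing unless both
  are below \<open>m\<close>; the product topology on functions then is the usual topology on matrices.\<close>

type_synonym rseq = "nat \<Rightarrow>\<^sub>0 real"

definition coord_space :: "nat \<Rightarrow> rseq set" where
  "coord_space m = {x. Poly_Mapping.keys x \<subseteq> {..<m}}"

definition mat_apply :: "nat \<Rightarrow> (nat \<Rightarrow> nat \<Rightarrow> real) \<Rightarrow> rseq \<Rightarrow> rseq" where
  "mat_apply m A x =
    (\<Sum>i<m. Poly_Mapping.single i (\<Sum>j<m. A i j * Poly_Mapping.lookup x j))"

definition mat_mult ::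
  "nat \<Rightarrow> (nat \<Rightarrow> nat \<Rightarrow> real) \<Rightarrow> (nat \<Rightarrow> nat \<Rightarrow> real) \<Rightarrow> (nat \<Rightarrow> nat \<Rightarrow> real)" where
  "mat_mult m A B = (\<lambda>i k. \<Sum>j<m. A i j * B j k)"

definition mat_transpose :: "(nat \<Rightarrow> nat \<Rightarrow> real) \<Rightarrow> (nat \<Rightarrow> nat \<Rightarrow> real)" where
  "mat_transpose A = (\<lambda>i j. A j i)"

definition Omega0_mat :: "nat \<Rightarrow> nat \<Rightarrow> nat \<Rightarrow> real" where
  "Omega0_mat n i j =
    (if i < n \<and> j = n + i then 1 else if j < n \<and> i = n + j then -1 else 0)"

definition Omega0 :: "nat \<Rightarrow> rseq \<Rightarrow> rseq \<Rightarrow> real" where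
  "Omega0 n v w =
    (\<Sum>i<2*n. \<Sum>j<2*n. Poly_Mapping.lookup v i * Omega0_mat n i j * Poly_Mapping.lookup w j)"

definition Sp :: "nat \<Rightarrow> (nat \<Rightarrow> nat \<Rightarrow> real) set" where
  "Sp n = {A. (\<forall>i j. \<not> (i < 2*n \<and> j < 2*n) \<longrightarrow> A i j = 0) \<and>
              mat_mult (2*n) (mat_mult (2*n) (mat_transpose A) (Omega0_mat n)) A = Omega0_mat n}"


section \<open>The two indices of a path of symplectic matrices\<close>

definition Omega_bar ::
  "nat \<Rightarrow> rseq \<times> rseq \<Rightarrow> rseq \<times> rseq \<Rightarrow> real" where
  "Omega_bar n p q = - Omega0 n (fst p) (fst q) + Omega0 n (snd p) (snd q)"

definition Gr ::
  "nat \<Rightarrow> (nat \<Rightarrow> nat \<Rightarrow> real) \<Rightarrow> (rseq \<times> rseq) set" where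
  "Gr n A = {(x, mat_apply (2*n) A x) | x. x \<in> coord_space (2*n)}"

definition diagonal :: "nat \<Rightarrow> (rseq \<times> rseq) set" where
  "diagonal n = {(x, x) | x. x \<in> coord_space (2*n)}"

definition mu_RS :: "nat \<Rightarrow> real \<Rightarrow> real \<Rightarrow> (real \<Rightarrow> nat \<Rightarrow> nat \<Rightarrow> real) \<Rightarrow> real" where
  "mu_RS n a b \<psi> =
    rs_index (coord_space (2*n) \<times> coord_space (2*n)) (Omega_bar n) a b
      (\<lambda>t. Gr n (\<psi> t)) (diagonal n)"

definition vertical :: "nat \<Rightarrow> rseq set" where
  "vertical n = {x \<in> coord_space (2*n). \<forall>i<n. Poly_Mapping.lookup x i = 0}"

definition mu_RS' :: "nat \<Rightarrow> real \<Rightarrow> real \<Rightarrow> (real \<Rightarrow> nat \<Rightarrow> nat \<Rightarrow> real) \<Rightarrow> real" where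
  "mu_RS' n a b \<psi> =
    rs_index (coord_space (2*n)) (Omega0 n) a b
      (\<lambda>t. mat_apply (2*n) (\<psi> t) ` vertical n) (vertical n)"

end

theory Submission
  imports Defs
begin

text \<open>Both indices are determined modulo 1 by the end points of the path: the interior crossings
  contribute integers, and the signature of a nondegenerate form has the parity of the dimension.
  So no homotopy invariance is needed to separate them, only a path for which the half-integral
  end point contributions differ. For \<open>n = 1\<close>, the shears \<open>\<psi>\<^sub>t = ((-1, t), (0, -1))\<close> never have
  the eigenvalue 1, so the graph misses the diagonal and \<open>\<mu>\<^sub>R\<^sub>S\<close> is an integer, while \<open>\<psi>\<^sub>t L\<close> is
  spanned by \<open>(t, -1)\<close> and meets \<open>L\<close> at \<open>t = 0\<close> in a line and at \<open>t = 1\<close> trivially, so \<open>\<mu>'\<^sub>R\<^sub>S\<close> is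
  a half-integer. Both paths are smooth with regular crossings only, hence the choice in the
  definition of the index is not over an empty set.\<close>

section \<open>Signatures of forms on the zero space and on a line\<close>

text \<open>This gives the contribution of an end point that is not a crossing. Every eigenspace
  lies in the zero space, so all summands are 0, whatever basis the definition picks.\<close>

lemma signature_zero_space: "signature {0 :: 'a::real_vector} B = 0"
proof -
  have "dim (form_eigenspace E {0} B l) = 0" for E :: "'a set" and l
  proof -
    \<comment> \<open>\<open>B\<close> is arbitrary, so \<open>B 0 0\<close> may be nonzero and the
      eigenspace empty. Such an \<open>l\<close> formally counts as an eigenvalue, but its summand
      is still 0.\<close>
    have "form_eigenspace E {0} B l = {} \<or> form_eigenspace E {0} B l = {0}"
      by (auto simp: form_eigenspace_def)
    moreover have "dim ({} :: 'a set) = 0"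
      using dim_eq_card_independent[OF independent_empty] by simp
    moreover from this have "dim ({0} :: 'a set) = 0"
      by (metis dim_span span_empty)
    ultimately show ?thesis
      by metis
  qed
  then show ?thesis
    by (simp add: signature_def Let_def)
qed

text \<open>In a one-vector basis \<open>{e'}\<close> the inner product is \<open>c * d\<close> and
  the form is \<open>c * d * b\<close>, so \<open>b\<close> is the only eigenvalue and the whole
  line its eigenspace. The hypothesis \<open>scale\<close> is what bilinearity amounts to on a line.
  The later argument uses that the value is odd.\<close>

lemma signature_line:
  fixes B :: "'a::real_vector \<Rightarrow> 'a \<Rightarrow> real"
  assumes "e \<noteq> 0" and scale: "\<And>c d. B (c *\<^sub>R e) (d *\<^sub>R e) = c * d * B e e" and "B e e \<noteq> 0"
  shows "signature (span {e}) B \<in> {1, -1}"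
proof -
  define V where "V = span {e}"
  \<comment> \<open>This is the basis chosen inside \<open>signature\<close>. It need not be
    \<open>{e}\<close>, but it consists of a nonzero multiple \<open>r *\<^sub>R e\<close>, which
    changes the value of the form by the factor \<open>r * r\<close>.\<close>
  define E where "E = (SOME E. finite E \<and> independent E \<and> span E = V)"
  have "finite {e} \<and> independent {e} \<and> span {e} = V"
    using \<open>e \<noteq> 0\<close> by (simp add: V_def)
  then have E: "finite E" "independent E" "span E = V"
    unfolding E_def by (metis (mono_tags, lifting) someI_ex)+
  have dimV: "dim V = 1"
    unfolding V_def using \<open>e \<noteq> 0\<close>
    using dim_span_eq_card_independent[of "{e}"] by simp
  then have "card E = 1"
    using E by (metis dim_span_eq_card_independent)
  then obtain e' where e': "E = {e'}"
    by (auto simp: card_1_singleton_iff)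
  have e'0: "e' \<noteq> 0"
    using E e' dependent_zero by blast
  have "e' \<in> span {e}"
    using E e' by (metis V_def insertI1 span_base)
  then obtain r where r: "e' = r *\<^sub>R e"
    by (auto simp: span_singleton)
  define b where "b = B e' e'"
  have "r \<noteq> 0"
    using r e'0 by auto
  have b: "b = r * r * B e e"
    using scale by (simp add: b_def r)
  have b0: "b \<noteq> 0"
    using \<open>r \<noteq> 0\<close> \<open>B e e \<noteq> 0\<close> by (simp add: b)
  have B: "B (c *\<^sub>R e') (d *\<^sub>R e') = c * d * b" for c d
    using scale[of "c * r" "d * r"] by (simp add: r b)
  have I: "basis_inner E (c *\<^sub>R e') (d *\<^sub>R e') = c * d" for c d
  proof -
    have "representation E (x *\<^sub>R e') e' = x" for x
      using E e' by (subst representation_scale) (auto simp: span_base representation_basis)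
    then show ?thesis
      by (simp add: basis_inner_def e')
  qed
  have V: "V = range (\<lambda>c. c *\<^sub>R e')"
    using E e' by (simp add: span_singleton)
  have mem: "c *\<^sub>R e' \<in> form_eigenspace E V B l \<longleftrightarrow> c = 0 \<or> l = b" for c l
  proof -
    have "c *\<^sub>R e' \<in> form_eigenspace E V B l \<longleftrightarrow> (\<forall>d. c * d * b = l * (c * d))"
      unfolding form_eigenspace_def V by (auto simp only: mem_Collect_eq B I ball_simps rangeI)
    also have "\<dots> \<longleftrightarrow> c * b = l * c"
      by (metis mult.commute mult.left_commute mult_1)
    finally show ?thesis
      by auto
  qed
  have es: "form_eigenspace E V B l = (if l = b then V else {0})" for l
  proof (cases "l = b")
    case True
    have "form_eigenspace E V B l \<subseteq> V"
      by (auto simp: form_eigenspace_def)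
    moreover have "V \<subseteq> form_eigenspace E V B l"
      using V mem True by auto
    ultimately show ?thesis
      using True by simp
  next
    case False
    have "form_eigenspace E V B l \<subseteq> {0}"
    proof
      fix v assume v: "v \<in> form_eigenspace E V B l"
      then obtain c where "v = c *\<^sub>R e'"
        using V by (auto simp: form_eigenspace_def)
      then show "v \<in> {0}"
        using mem[of c l] v False by simp
    qed
    moreover have "0 \<in> form_eigenspace E V B l"
      using mem[of 0 l] by simp
    ultimately show ?thesis
      using False by auto
  qed
  have "V \<noteq> {0}"
    using E e' e'0 by (metis insertI1 singletonD span_base)
  then have ev: "form_eigenvalues E V B = {b}"
    by (auto simp: form_eigenvalues_def es)
  have sig: "signature V B =
      (\<Sum>l | l \<in> {b} \<and> l > 0. int (dim (form_eigenspace E V B l)))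
      - (\<Sum>l | l \<in> {b} \<and> l < 0. int (dim (form_eigenspace E V B l)))"
    unfolding signature_def Let_def E_def[symmetric] ev ..
  show ?thesis
  proof (cases "b > 0")
    case True
    then have "{l. l \<in> {b} \<and> l > 0} = {b}" "{l. l \<in> {b} \<and> l < 0} = {}"
      by auto
    then show ?thesis
      unfolding V_def[symmetric] sig by (simp add: es dimV)
  next
    case False
    then have "{l. l \<in> {b} \<and> l > 0} = {}" "{l. l \<in> {b} \<and> l < 0} = {b}"
      using b0 by auto
    then show ?thesis
      unfolding V_def[symmetric] sig by (simp add: es dimV)
  qed
qed


section \<open>Paths of Lagrangian subspaces\<close>

text \<open>Lagrangians carry the quotient topology under the span map, so a path is continuous as
  soon as it lifts to a continuous path of frames.\<close>

lemma continuous_map_span_frames: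
  assumes "continuous_on S f" "f ` S \<subseteq> lagrangian_frames W \<Omega> k"
  shows "continuous_map (top_of_set S) (lagrangian_topology W \<Omega>) (\<lambda>t. span (f t ` {..<k}))"
  unfolding continuous_map_def
proof (intro conjI allI impI)
  show "(\<lambda>t. span (f t ` {..<k})) \<in> topspace (top_of_set S) \<rightarrow> topspace (lagrangian_topology W \<Omega>)"
    using assms(2) by (auto simp: topspace_lagrangian_topology lagrangian_frames_def)
next
  fix U assume "openin (lagrangian_topology W \<Omega>) U"
  then have "openin (top_of_set (lagrangian_frames W \<Omega> k))
      {f \<in> lagrangian_frames W \<Omega> k. span (f ` {..<k}) \<in> U}"
    by (simp add: openin_lagrangian_topology openin_lagrangians_def)
  then have "openin (top_of_set S) (S \<inter> f -` {f \<in> lagrangian_frames W \<Omega> k. span (f ` {..<k}) \<in> U})"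
    using assms by (intro continuous_openin_preimage) auto
  also have "S \<inter> f -` {f \<in> lagrangian_frames W \<Omega> k. span (f ` {..<k}) \<in> U} =
      {t \<in> topspace (top_of_set S). span (f t ` {..<k}) \<in> U}"
    using assms(2) by auto
  finally show "openin (top_of_set S) {t \<in> topspace (top_of_set S). span (f t ` {..<k}) \<in> U}" .
qed

lemma smooth_on_affine: "smooth_on S (\<lambda>t. u + t *\<^sub>R v)"
proof -
  define D where "D k t = (if k = 0 then u + t *\<^sub>R v else if k = 1 then v else 0)" for k :: nat and t
  have "(D k has_vector_derivative D (Suc k) t) (at t within S)" for k t
    unfolding D_def by (cases "k = 0"; cases "k = 1") (auto intro!: derivative_eq_intros)
  then show ?thesis
    unfolding smooth_on_def by (intro exI[of _ D]) (auto simp: D_def)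
qed

lemma smooth_graph_at_derivative:
  assumes g: "smooth_graph_at W \<Omega> a b \<Lambda> t0 M \<alpha>" and "t0 \<in> {a..b}" "v \<in> \<Lambda> t0"
  obtains D where "((\<lambda>t. \<alpha> t v) has_vector_derivative D) (at t0 within {a..b})"
proof -
  obtain e where e: "e > 0" "smooth_on ({a..b} \<inter> {t0 - e<..<t0 + e}) (\<lambda>t. \<alpha> t v)"
    using g \<open>v \<in> \<Lambda> t0\<close> unfolding smooth_graph_at_def by blast
  let ?S = "{a..b} \<inter> {t0 - e<..<t0 + e}"
  have t0: "t0 \<in> ?S"
    using e \<open>t0 \<in> {a..b}\<close> by auto
  obtain D where D: "\<forall>t\<in>?S. D (0::nat) t = \<alpha> t v"
      "\<forall>k. \<forall>t\<in>?S. (D k has_vector_derivative D (Suc k) t) (at t within ?S)"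
    using e(2) unfolding smooth_on_def by blast
  have "(D 0 has_vector_derivative D 1 t0) (at t0 within ?S)"
    using D(2) t0 by auto
  then have "((\<lambda>t. \<alpha> t v) has_vector_derivative D 1 t0) (at t0 within ?S)"
    by (rule has_vector_derivative_transform[rotated 2]) (use D(1) t0 in auto)
  \<comment> \<open>Smoothness is known only near \<open>t0\<close>, while
    \<open>velocity_form\<close> differentiates within the whole interval. The two filters agree,
    and at an end point both are one-sided.\<close>
  moreover have "at t0 within ?S = at t0 within {a..b}"
    using e(1) by (intro at_within_nhd[of _ "{t0 - e<..<t0 + e}"]) auto
  ultimately show thesis
    using that by auto
qed

lemma smooth_graph_at_nhd:
  assumes "smooth_graph_at W \<Omega> a b \<Lambda> t0 M \<alpha>"
  obtains e where "e > 0"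
    "\<And>t v. t \<in> {a..b} \<Longrightarrow> \<bar>t - t0\<bar> < e \<Longrightarrow> v \<in> \<Lambda> t0 \<Longrightarrow> \<alpha> t v \<in> M"
    "\<And>t v c. t \<in> {a..b} \<Longrightarrow> \<bar>t - t0\<bar> < e \<Longrightarrow> v \<in> \<Lambda> t0 \<Longrightarrow> \<alpha> t (c *\<^sub>R v) = c *\<^sub>R \<alpha> t v"
    "\<And>t. t \<in> {a..b} \<Longrightarrow> \<bar>t - t0\<bar> < e \<Longrightarrow> \<Lambda> t = {v + \<alpha> t v | v. v \<in> \<Lambda> t0}"
proof -
  let ?P = "\<lambda>t. (\<forall>v\<in>\<Lambda> t0. \<alpha> t v \<in> M) \<and> (\<forall>c. \<forall>v\<in>\<Lambda> t0. \<alpha> t (c *\<^sub>R v) = c *\<^sub>R \<alpha> t v) \<and>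
    \<Lambda> t = {v + \<alpha> t v | v. v \<in> \<Lambda> t0}"
  obtain e where e: "e > 0" "\<forall>t\<in>{a..b} \<inter> {t0 - e<..<t0 + e}. ?P t"
    using assms unfolding smooth_graph_at_def by (elim conjE exE) (rule that, assumption, simp)
  have "?P t" if "t \<in> {a..b}" "\<bar>t - t0\<bar> < e" for t
    using e(2)[rule_format, of t] that by (simp only: Int_iff greaterThanLessThan_iff abs_less_iff) argo
  then show thesis
    by (intro that[OF e(1)]) blast+
qed

text \<open>This covers charts given by one formula for all times and on the whole ambient space, as
  for both shear paths below. Any radius then works, and 1 is taken.\<close>

lemma smooth_graph_atI:
  assumes "lagrangian W \<Omega> M" "direct_sum W (\<Lambda> t0) M"
    and "\<And>t v. \<alpha> t v \<in> M" "\<And>t u v. \<alpha> t (u + v) = \<alpha> t u + \<alpha> t v" "\<And>t c v. \<alpha> t (c *\<^sub>R v) = c *\<^sub>R \<alpha> t v"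
    and "\<And>t. \<Lambda> t = {v + \<alpha> t v | v. v \<in> \<Lambda> t0}" "\<And>S v. smooth_on S (\<lambda>t. \<alpha> t v)"
  shows "smooth_graph_at W \<Omega> a b \<Lambda> t0 M \<alpha>"
  unfolding smooth_graph_at_def
  by (intro conjI exI[of _ "1::real"] ballI allI) (rule assms zero_less_one)+

text \<open>The chart in \<open>velocity_form\<close> is an unspecified choice, but each
  \<open>\<alpha> t\<close> is linear on \<open>\<Lambda> t0\<close> for \<open>t\<close> near
  \<open>t0\<close>, and differentiation preserves homogeneity. The hypothesis \<open>a < b\<close>
  makes the derivative within the interval unique.\<close>

lemma velocity_form_scale:
  assumes path: "smooth_lagrangian_path W \<Omega> a b \<Lambda>" and "a < b" "t0 \<in> {a..b}"
    and \<Omega>_right: "\<And>v. bounded_linear (\<Omega> v)" and \<Omega>_left: "\<And>c v w. \<Omega> (c *\<^sub>R v) w = c * \<Omega> v w"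
    and "w \<in> \<Lambda> t0"
  shows "velocity_form W \<Omega> a b \<Lambda> t0 (c *\<^sub>R v) (d *\<^sub>R w) = c * d * velocity_form W \<Omega> a b \<Lambda> t0 v w"
proof -
  define \<alpha> where "\<alpha> = (SOME \<alpha>. \<exists>M. smooth_graph_at W \<Omega> a b \<Lambda> t0 M \<alpha>)"
  have "\<exists>\<alpha> M. smooth_graph_at W \<Omega> a b \<Lambda> t0 M \<alpha>"
    using path \<open>t0 \<in> {a..b}\<close> unfolding smooth_lagrangian_path_def by blast
  then have "\<exists>M. smooth_graph_at W \<Omega> a b \<Lambda> t0 M \<alpha>"
    unfolding \<alpha>_def by (rule someI_ex)
  then obtain M where g: "smooth_graph_at W \<Omega> a b \<Lambda> t0 M \<alpha>" ..
  obtain D where D: "((\<lambda>t. \<alpha> t w) has_vector_derivative D) (at t0 within {a..b})"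
    using smooth_graph_at_derivative[OF g \<open>t0 \<in> {a..b}\<close> \<open>w \<in> \<Lambda> t0\<close>] by blast
  obtain e where "e > 0" and e: "\<And>t v c. t \<in> {a..b} \<Longrightarrow> \<bar>t - t0\<bar> < e \<Longrightarrow> v \<in> \<Lambda> t0 \<Longrightarrow> \<alpha> t (c *\<^sub>R v) = c *\<^sub>R \<alpha> t v"
    by (rule smooth_graph_at_nhd[OF g]) (rule that)
  have vd: "vector_derivative f (at t0 within {a..b}) = f'"
    if "(f has_vector_derivative f') (at t0 within {a..b})" for f :: "real \<Rightarrow> real" and f'
    using vector_derivative_within_closed_interval \<open>a < b\<close> \<open>t0 \<in> {a..b}\<close> that by blast
  have d1: "((\<lambda>t. \<Omega> v (\<alpha> t w)) has_vector_derivative \<Omega> v D) (at t0 within {a..b})"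
    using bounded_linear.has_vector_derivative[OF \<Omega>_right D] .
  then have d1': "((\<lambda>t. (c * d) * \<Omega> v (\<alpha> t w)) has_vector_derivative (c * d) * \<Omega> v D) (at t0 within {a..b})"
    by (rule has_vector_derivative_mult_right)
  have \<Omega>_scale: "\<Omega> v (x *\<^sub>R u) = x * \<Omega> v u" for x u
    using linear_cmul[OF bounded_linear.linear[OF \<Omega>_right]] by simp
  have d2: "((\<lambda>t. \<Omega> (c *\<^sub>R v) (\<alpha> t (d *\<^sub>R w))) has_vector_derivative (c * d) * \<Omega> v D)
      (at t0 within {a..b})"
    \<comment> \<open>Homogeneity of \<open>\<alpha> t\<close> holds only for \<open>t\<close>
      within \<open>e\<close> of \<open>t0\<close>, so the two functions are compared on that
      neighbourhood.\<close>
    by (rule has_vector_derivative_transform_within[OF d1' \<open>e > 0\<close> \<open>t0 \<in> {a..b}\<close>])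
      (subst e, auto simp: \<open>w \<in> \<Lambda> t0\<close> \<Omega>_left \<Omega>_scale dist_real_def)
  show ?thesis
    unfolding velocity_form_def Let_def \<alpha>_def[symmetric] vd[OF d1] vd[OF d2] by simp
qed

text \<open>A regular smooth continuous path is homotopic to itself, so the choice in
  \<open>rs_index\<close> is over a nonempty set. The chosen representative may differ from the path
  in the interior, but the homotopy fixes its end points.\<close>

lemma representative_exists:
  assumes "smooth_lagrangian_path W \<Omega> a b \<Lambda>" "regular_crossings W \<Omega> a b \<Lambda> L"
    and "continuous_map (top_of_set {a..b}) (lagrangian_topology W \<Omega>) \<Lambda>"
  obtains \<Lambda>' where "rs_index W \<Omega> a b \<Lambda> L = regular_rs_index W \<Omega> a b \<Lambda>' L"
    "smooth_lagrangian_path W \<Omega> a b \<Lambda>'" "regular_crossings W \<Omega> a b \<Lambda>' L"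
    "\<Lambda>' a = \<Lambda> a" "\<Lambda>' b = \<Lambda> b"
proof -
  let ?P = "\<lambda>\<Lambda>'. smooth_lagrangian_path W \<Omega> a b \<Lambda>' \<and> regular_crossings W \<Omega> a b \<Lambda>' L \<and>
      homotopic_fixed_ends W \<Omega> a b \<Lambda> \<Lambda>'"
  have "?P \<Lambda>"
    using assms by (simp add: homotopic_fixed_ends_def)
  then have "?P (SOME \<Lambda>'. ?P \<Lambda>')"
    by (rule someI[of ?P])
  then show thesis
    by (intro that[of "SOME \<Lambda>'. ?P \<Lambda>'"])
      (auto simp: rs_index_def homotopic_fixed_ends_def dest: homotopic_with_imp_property)
qed


section \<open>The plane\<close>

definition vec2 :: "real \<Rightarrow> real \<Rightarrow> rseq" where
  "vec2 x y = Poly_Mapping.single 0 x + Poly_Mapping.single 1 y"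

lemma lookup_scaleR: "Poly_Mapping.lookup (c *\<^sub>R v) i = c * Poly_Mapping.lookup v i" for v :: rseq
proof -
  have "finite {i. c *\<^sub>R Poly_Mapping.lookup v i \<noteq> 0}"
    by (rule finite_subset[OF _ finite_lookup[of v]]) auto
  then show ?thesis
    by (simp add: scaleR_poly_mapping_def)
qed

lemma lookup_vec2 [simp]:
  "Poly_Mapping.lookup (vec2 x y) i = (if i = 0 then x else if i = 1 then y else 0)"
  by (auto simp: vec2_def lookup_add lookup_single when_def)

lemma vec2_eq_iff [simp]: "vec2 x y = vec2 x' y' \<longleftrightarrow> x = x' \<and> y = y'"
proof
  assume "vec2 x y = vec2 x' y'"
  then have "Poly_Mapping.lookup (vec2 x y) i = Poly_Mapping.lookup (vec2 x' y') i" for i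
    by simp
  from this[of 0] this[of 1] show "x = x' \<and> y = y'"
    by simp
qed simp

lemma vec2_add [simp]: "vec2 x y + vec2 x' y' = vec2 (x + x') (y + y')"
  by (rule poly_mapping_eqI) (simp add: lookup_add)

lemma vec2_scaleR [simp]: "c *\<^sub>R vec2 x y = vec2 (c * x) (c * y)"
  by (rule poly_mapping_eqI) (simp add: lookup_scaleR)

lemma vec2_zero: "0 = vec2 0 0"
  by (rule poly_mapping_eqI) simp

lemma vec2_eq_0_iff [simp]: "vec2 x y = 0 \<longleftrightarrow> x = 0 \<and> y = 0"
  by (simp add: vec2_zero)

lemma coord_space_2: "coord_space 2 = {vec2 x y | x y. True}"
proof (intro equalityI subsetI)
  fix v assume v: "v \<in> coord_space 2"
  have "v = vec2 (Poly_Mapping.lookup v 0) (Poly_Mapping.lookup v 1)"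
  proof (rule poly_mapping_eqI)
    fix i
    have "Poly_Mapping.lookup v i = 0" if "i \<ge> 2"
      using v that by (force simp: coord_space_def in_keys_iff)
    then show "Poly_Mapping.lookup v i =
        Poly_Mapping.lookup (vec2 (Poly_Mapping.lookup v 0) (Poly_Mapping.lookup v 1)) i"
      by auto
  qed
  then show "v \<in> {vec2 x y | x y. True}"
    by blast
qed (auto simp: coord_space_def in_keys_iff split: if_splits)

lemma vertical_1: "vertical 1 = {vec2 0 y | y. True}"
  by (auto simp: vertical_def coord_space_2)

text \<open>The norm is the sum of the absolute values of the coordinates, hence the bound 1.
  Derivatives can therefore be taken coordinatewise.\<close>

lemma bounded_linear_lookup: "bounded_linear (\<lambda>v :: rseq. Poly_Mapping.lookup v i)"
proof (rule bounded_linear_intro[of _ 1])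
  fix v :: rseq
  show "norm (Poly_Mapping.lookup v i) \<le> norm v * 1"
  proof (cases "i \<in> Poly_Mapping.keys v")
    case True
    then have "norm (Poly_Mapping.lookup v i) \<le> (\<Sum>n\<in>Poly_Mapping.keys v. norm (Poly_Mapping.lookup v n))"
      by (intro member_le_sum) auto
    then show ?thesis
      by (simp add: norm_poly_mapping_def dist_poly_mapping_def)
  qed (simp add: in_keys_iff)
qed (simp_all add: lookup_add lookup_scaleR)

lemma Omega0_1:
  "Omega0 1 v w = Poly_Mapping.lookup v 0 * Poly_Mapping.lookup w 1
    - Poly_Mapping.lookup v 1 * Poly_Mapping.lookup w 0"
  by (simp add: Omega0_def Omega0_mat_def numeral_2_eq_2)

lemma Omega0_1_vec2 [simp]: "Omega0 (Suc 0) (vec2 x y) (vec2 x' y') = x * y' - y * x'"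
  using Omega0_1[of "vec2 x y" "vec2 x' y'"] by simp

lemma bounded_linear_Omega0_1: "bounded_linear (Omega0 1 v)"
  unfolding Omega0_1
  by (intro bounded_linear_sub bounded_linear_const_mult bounded_linear_lookup)


section \<open>A path of shears\<close>

definition shear :: "real \<Rightarrow> nat \<Rightarrow> nat \<Rightarrow> real" where
  "shear t i j = (if i = 0 \<and> j = 0 \<or> i = 1 \<and> j = 1 then -1 else if i = 0 \<and> j = 1 then t else 0)"

lemma continuous_on_shear: "continuous_on S shear"
proof (intro continuous_on_coordinatewise_then_product)
  fix i j
  have "(\<lambda>t. shear t i j) = (if i = 0 \<and> j = 0 \<or> i = 1 \<and> j = 1 then (\<lambda>_. -1)
      else if i = 0 \<and> j = 1 then (\<lambda>t. t) else (\<lambda>_. 0))"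
    by (auto simp: shear_def)
  then show "continuous_on S (\<lambda>t. shear t i j)"
    by (simp only: continuous_on_const continuous_on_id split: if_split) simp
qed

text \<open>For \<open>n = 1\<close> being symplectic means having determinant 1, here (-1)(-1).
  Indices from 2 on give 0 on both sides.\<close>

lemma shear_in_Sp: "shear t \<in> Sp 1"
proof -
  have "mat_mult 2 (mat_mult 2 (mat_transpose (shear t)) (Omega0_mat 1)) (shear t) i j =
      Omega0_mat 1 i j" for i j
  proof -
    have cases: "k = 0 \<or> k = 1 \<or> k \<ge> 2" for k :: nat
      by auto
    show ?thesis
      using cases[of i] cases[of j]
      by (elim disjE) (simp_all add: mat_mult_def mat_transpose_def Omega0_mat_def shear_def numeral_2_eq_2)
  qed
  then show ?thesis
    by (auto simp: Sp_def shear_def fun_eq_iff)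
qed

lemma mat_apply_shear [simp]: "mat_apply 2 (shear t) (vec2 x y) = vec2 (t * y - x) (- y)"
proof -
  have "{..<2} = {0, 1 :: nat}"
    by auto
  then show ?thesis
    unfolding mat_apply_def vec2_def[of "t * y - x" "- y"] by (simp add: shear_def)
qed


section \<open>The images of the vertical line\<close>

definition shear_line :: "real \<Rightarrow> rseq set" where
  "shear_line t = mat_apply 2 (shear t) ` vertical 1"

lemma shear_line_eq: "shear_line t = {vec2 (t * y) (- y) | y. True}"
proof -
  have "shear_line t = mat_apply 2 (shear t) ` range (vec2 0)"
    unfolding shear_line_def vertical_1 by (rule arg_cong[of _ _ "image _"]) auto
  then show ?thesis
    by (auto simp: image_def)
qed

lemma span_vec2: "span {vec2 a b} = {vec2 (c * a) (c * b) | c. True}"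
  by (auto simp: span_singleton)

text \<open>\<open>Omega0 1\<close> is the area form of the plane. It vanishes on two vectors
  exactly when they are proportional, so every line is its own orthogonal complement.\<close>

lemma lagrangian_line:
  assumes "a \<noteq> 0 \<or> b \<noteq> 0"
  shows "lagrangian (coord_space 2) (Omega0 1) (span {vec2 a b})"
  unfolding lagrangian_def
proof (intro conjI)
  show "span {vec2 a b} \<subseteq> coord_space 2"
    by (auto simp: span_vec2 coord_space_2)
  have "vec2 p q \<in> span {vec2 a b}" if "a * q = b * p" for p q
  proof (cases "a = 0")
    case True
    then show ?thesis
      using that assms by (auto simp: span_vec2 intro!: exI[of _ "q / b"])
  next
    case False
    then show ?thesis
      using that by (auto simp: span_vec2 field_simps intro!: exI[of _ "p / a"])
  qed
  then have "w \<in> span {vec2 a b}" if "w \<in> coord_space 2" "\<forall>v\<in>span {vec2 a b}. Omega0 1 v w = 0" for w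
    using that(1) that(2)[rule_format, OF span_base[of "vec2 a b"]] by (auto simp: coord_space_2)
  moreover have "w \<in> coord_space 2 \<and> (\<forall>v\<in>span {vec2 a b}. Omega0 1 v w = 0)"
    if "w \<in> span {vec2 a b}" for w
    using that by (auto simp: span_vec2 coord_space_2)
  ultimately show "{w \<in> coord_space 2. \<forall>v\<in>span {vec2 a b}. Omega0 1 v w = 0} = span {vec2 a b}"
    by blast
qed (simp add: subspace_span)

lemma shear_line_span: "shear_line t = span {vec2 t (-1)}"
  unfolding shear_line_eq span_vec2 by (auto simp: mult.commute)

lemma lagrangian_shear_line: "lagrangian (coord_space 2) (Omega0 1) (shear_line t)"
  unfolding shear_line_span by (rule lagrangian_line) simp

lemma continuous_map_shear_line:
  "continuous_map (top_of_set S) (lagrangian_topology (coord_space 2) (Omega0 1)) shear_line"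
proof -
  define f where "f t i = (if i = 0 then vec2 t (-1) else 0)" for t and i :: nat
  have img: "f t ` {..<1} = {vec2 t (-1)}" for t
    by (auto simp: f_def)
  have "continuous_on S (\<lambda>t. vec2 0 (-1) + t *\<^sub>R vec2 1 0)"
    by (intro continuous_intros)
  then have "continuous_on S (\<lambda>t. f t i)" for i
    by (cases "i = 0") (simp_all add: f_def)
  then have "continuous_on S f"
    by (rule continuous_on_coordinatewise_then_product)
  moreover have "f t \<in> lagrangian_frames (coord_space 2) (Omega0 1) 1" for t
    unfolding lagrangian_frames_def mem_Collect_eq img
    by (simp add: lagrangian_line[simplified] inj_on_def lessThan_Suc) (simp add: f_def)
  ultimately have "continuous_map (top_of_set S) (lagrangian_topology (coord_space 2) (Omega0 1))
      (\<lambda>t. span (f t ` {..<1}))"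
    by (intro continuous_map_span_frames) auto
  then show ?thesis
    unfolding img shear_line_span[symmetric] by simp
qed

lemma smooth_shear_line: "smooth_lagrangian_path (coord_space 2) (Omega0 1) a b shear_line"
proof -
  have "\<exists>M \<alpha>. smooth_graph_at (coord_space 2) (Omega0 1) a b shear_line t0 M \<alpha>" for t0
  proof -
    \<comment> \<open>The horizontal axis is a complement of every \<open>shear_line t\<close>. The
      map carries (t0 y, -y) to (t y, -y), and the second coordinate is -y, hence the factor
      \<open>t0 - t\<close>.\<close>
    define \<alpha> where "\<alpha> t v = vec2 ((t0 - t) * Poly_Mapping.lookup v 1) 0" for t and v :: rseq
    have "\<exists>v m. vec2 x y = v + m \<and> v \<in> shear_line t0 \<and> m \<in> span {vec2 1 0}" for x y
      by (rule exI[of _ "vec2 (t0 * (- y)) y"], rule exI[of _ "vec2 (x + t0 * y) 0"])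
        (auto simp: shear_line_eq span_vec2 intro: exI[of _ "- y"])
    then have sum: "direct_sum (coord_space 2) (shear_line t0) (span {vec2 1 0})"
      unfolding direct_sum_def coord_space_2 shear_line_eq span_vec2
      by (fastforce simp: vec2_zero)
    have "vec2 (t0 * y) (- y) + \<alpha> t (vec2 (t0 * y) (- y)) = vec2 (t * y) (- y)" for t y
      by (simp add: \<alpha>_def algebra_simps)
    then have graph: "shear_line t = {v + \<alpha> t v |v. v \<in> shear_line t0}" for t
      unfolding shear_line_eq by (auto, metis)
    have "(\<lambda>t. \<alpha> t v) =
        (\<lambda>t. vec2 (t0 * Poly_Mapping.lookup v 1) 0 + t *\<^sub>R vec2 (- Poly_Mapping.lookup v 1) 0)" for v
      by (simp add: \<alpha>_def algebra_simps)
    then have smooth: "smooth_on S (\<lambda>t. \<alpha> t v)" for S v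
      by (simp only: smooth_on_affine)
    have "\<alpha> t v \<in> span {vec2 1 0}" for t v
      by (auto simp: \<alpha>_def span_vec2)
    moreover have "\<alpha> t (u + v) = \<alpha> t u + \<alpha> t v" "\<alpha> t (c *\<^sub>R v) = c *\<^sub>R \<alpha> t v" for t u v c
      by (simp_all add: \<alpha>_def lookup_add lookup_scaleR algebra_simps)
    ultimately have "smooth_graph_at (coord_space 2) (Omega0 1) a b shear_line t0 (span {vec2 1 0}) \<alpha>"
      by (intro smooth_graph_atI lagrangian_line sum graph smooth) simp_all
    then show ?thesis
      by blast
  qed
  then show ?thesis
    using lagrangian_shear_line unfolding smooth_lagrangian_path_def by blast
qed

lemma shear_line_Int_vertical: "shear_line t \<inter> vertical 1 = (if t = 0 then span {vec2 0 1} else {0})"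
proof -
  have "span {vec2 0 1} = vertical 1"
    unfolding span_vec2 vertical_1 by auto
  moreover have "shear_line 0 = vertical 1"
    unfolding shear_line_eq vertical_1 by (auto, metis minus_minus)
  moreover have "shear_line t \<inter> vertical 1 = {0}" if "t \<noteq> 0"
    using that unfolding shear_line_eq vertical_1 by (auto simp: vec2_zero)
  ultimately show ?thesis
    by simp
qed

lemma vec2_01_in_shear_line_0: "vec2 0 1 \<in> shear_line 0"
  by (auto simp: shear_line_eq intro!: exI[of _ "-1"])

text \<open>The chart, and with it the complement \<open>M\<close>, is an unspecified choice, so the
  value is computed for an arbitrary \<open>M\<close>.\<close>

lemma velocity_form_shear_line_0:
  assumes "b > 0"
  shows "velocity_form (coord_space 2) (Omega0 1) 0 b shear_line 0 (vec2 0 1) (vec2 0 1) = 1"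
proof -
  define \<alpha> where "\<alpha> = (SOME \<alpha>. \<exists>M. smooth_graph_at (coord_space 2) (Omega0 1) 0 b shear_line 0 M \<alpha>)"
  define e where "e = vec2 0 1"
  have eL: "e \<in> shear_line 0"
    by (simp add: e_def vec2_01_in_shear_line_0)
  have 0: "(0::real) \<in> {0..b}"
    using \<open>b > 0\<close> by simp
  have "\<exists>\<alpha> M. smooth_graph_at (coord_space 2) (Omega0 1) 0 b shear_line 0 M \<alpha>"
    using smooth_shear_line[of 0 b] 0 unfolding smooth_lagrangian_path_def by blast
  then have "\<exists>M. smooth_graph_at (coord_space 2) (Omega0 1) 0 b shear_line 0 M \<alpha>"
    unfolding \<alpha>_def by (rule someI_ex)
  then obtain M where g: "smooth_graph_at (coord_space 2) (Omega0 1) 0 b shear_line 0 M \<alpha>" ..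
  obtain D where D: "((\<lambda>t. \<alpha> t e) has_vector_derivative D) (at 0 within {0..b})"
    using smooth_graph_at_derivative[OF g 0 eL] by blast
  obtain \<epsilon> where \<epsilon>: "\<epsilon> > 0"
    "\<And>t v. t \<in> {0..b} \<Longrightarrow> \<bar>t - 0\<bar> < \<epsilon> \<Longrightarrow> v \<in> shear_line 0 \<Longrightarrow> \<alpha> t v \<in> M"
    "\<And>t. t \<in> {0..b} \<Longrightarrow> \<bar>t - 0\<bar> < \<epsilon> \<Longrightarrow> shear_line t = {v + \<alpha> t v | v. v \<in> shear_line 0}"
    by (rule smooth_graph_at_nhd[OF g]) (rule that)
  have M: "shear_line 0 \<inter> M = {0}"
    using g by (simp add: smooth_graph_at_def direct_sum_def)
  have sub: "subspace (shear_line 0)"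
    by (simp add: shear_line_span)
  \<comment> \<open>At time 0 the chart map vanishes: \<open>\<alpha> 0 e\<close> lies both in
    \<open>shear_line 0\<close> and in \<open>M\<close>.\<close>
  have "e + \<alpha> 0 e \<in> shear_line 0"
    using \<epsilon>(3)[of 0] eL \<open>b > 0\<close> \<open>\<epsilon> > 0\<close> by auto
  then have "\<alpha> 0 e \<in> shear_line 0"
    using subspace_diff[OF sub _ eL] by fastforce
  then have \<alpha>0: "\<alpha> 0 e = 0"
    using M \<epsilon>(1) \<epsilon>(2)[of 0 e] eL \<open>b > 0\<close> by auto
  \<comment> \<open>The intersection of \<open>e + M\<close> with the line spanned by \<open>(t, -1)\<close> is \<open>(-t z(t), z(t))\<close>, so that
    \<open>\<Omega>(e, \<alpha>\<^sub>t e) = t z(t)\<close> with \<open>z(0) = 1\<close>, whatever the complement \<open>M\<close>.\<close>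
  define z where "z t = 1 + Poly_Mapping.lookup (\<alpha> t e) 1" for t
  have Omega: "Omega0 1 e (\<alpha> t e) = t * z t" if t: "t \<in> {0..b}" "dist t 0 < \<epsilon>" for t
  proof -
    have "e + \<alpha> t e \<in> shear_line t"
      using \<epsilon>(3)[of t] t eL by (auto simp: dist_real_def)
    then obtain y where y: "e + \<alpha> t e = vec2 (t * y) (- y)"
      by (auto simp: shear_line_eq)
    have "Poly_Mapping.lookup (e + \<alpha> t e) i = Poly_Mapping.lookup (vec2 (t * y) (- y)) i" for i
      by (simp only: y)
    from this[of 0] this[of 1] show ?thesis
      by (simp add: Omega0_1[simplified] e_def z_def lookup_add)
  qed
  have "((\<lambda>t. Poly_Mapping.lookup (\<alpha> t e) 1) has_vector_derivative Poly_Mapping.lookup D 1) (at 0 within {0..b})"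
    using bounded_linear.has_vector_derivative[OF bounded_linear_lookup D] .
  then have "(z has_real_derivative Poly_Mapping.lookup D 1) (at 0 within {0..b})"
    unfolding z_def has_real_derivative_iff_has_vector_derivative[symmetric]
    by (auto intro!: derivative_eq_intros)
  \<comment> \<open>At t = 0 the product rule leaves only \<open>z 0\<close>, so the unknown
    derivative of \<open>z\<close> drops out.\<close>
  then have "((\<lambda>t. t * z t) has_real_derivative z 0) (at 0 within {0..b})"
    by (auto intro!: derivative_eq_intros)
  then have "((\<lambda>t. t * z t) has_vector_derivative 1) (at 0 within {0..b})"
    by (simp add: has_real_derivative_iff_has_vector_derivative z_def \<alpha>0)
  then have "((\<lambda>t. Omega0 1 e (\<alpha> t e)) has_vector_derivative 1) (at 0 within {0..b})"
    by (rule has_vector_derivative_transform_within[OF _ \<open>\<epsilon> > 0\<close> 0]) (simp only: Omega)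
  then show ?thesis
    unfolding velocity_form_def Let_def \<alpha>_def[symmetric] e_def[symmetric]
    using vector_derivative_within_closed_interval \<open>b > 0\<close> 0 by blast
qed

text \<open>Stated for an arbitrary smooth path, since it is applied both to
  \<open>shear_line\<close> and to the unknown representative.\<close>

lemma velocity_form_scale_plane:
  assumes "smooth_lagrangian_path (coord_space 2) (Omega0 1) 0 1 \<Lambda>" and "w \<in> \<Lambda> 0"
  shows "velocity_form (coord_space 2) (Omega0 1) 0 1 \<Lambda> 0 (c *\<^sub>R v) (d *\<^sub>R w) =
    c * d * velocity_form (coord_space 2) (Omega0 1) 0 1 \<Lambda> 0 v w"
proof (rule velocity_form_scale[OF assms(1) _ _ bounded_linear_Omega0_1 _ assms(2)])
  show "Omega0 1 (c *\<^sub>R v) w = c * Omega0 1 v w" for c v w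
    by (simp add: Omega0_1[simplified] lookup_scaleR algebra_simps)
qed simp_all

lemma regular_shear_line: "regular_crossings (coord_space 2) (Omega0 1) 0 1 shear_line (vertical 1)"
  unfolding regular_crossings_def
proof (intro ballI impI)
  fix t assume "crossing shear_line (vertical 1) t"
  then have [simp]: "t = 0"
    using shear_line_Int_vertical[of t] by (auto simp: crossing_def split: if_splits)
  let ?B = "velocity_form (coord_space 2) (Omega0 1) 0 1 shear_line 0"
  have "v = 0" if v: "v \<in> span {vec2 0 1}" "\<forall>w\<in>span {vec2 0 1}. ?B v w = 0" for v
  proof -
    obtain c where c: "v = c *\<^sub>R vec2 0 1"
      using v(1) by (auto simp: span_singleton)
    have "?B (c *\<^sub>R vec2 0 1) (1 *\<^sub>R vec2 0 1) = 0"
      using v(2) by (simp only: c scaleR_one span_base insertI1)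
    then have "c = 0"
      unfolding velocity_form_scale_plane[OF smooth_shear_line vec2_01_in_shear_line_0]
      using velocity_form_shear_line_0[of 1] by simp
    then show ?thesis
      by (simp only: c scaleR_zero_left)
  qed
  moreover have "shear_line t \<inter> vertical 1 = span {vec2 0 1}"
    using shear_line_Int_vertical[of 0] by simp
  ultimately show "nondegenerate_on (shear_line t \<inter> vertical 1)
      (velocity_form (coord_space 2) (Omega0 1) 0 1 shear_line t)"
    by (simp only: nondegenerate_on_def \<open>t = 0\<close>) blast
qed

text \<open>The representative starts at a crossing along a line and ends at no crossing. Its index
  is thus half of an odd number plus an integer.\<close>

lemma mu_RS'_shear: "mu_RS' 1 0 1 shear \<notin> \<int>"
proof -
  let ?W = "coord_space 2" and ?\<Omega> = "Omega0 1" and ?L = "vertical 1"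
  obtain \<Lambda> where \<Lambda>: "rs_index ?W ?\<Omega> 0 1 shear_line ?L = regular_rs_index ?W ?\<Omega> 0 1 \<Lambda> ?L"
    "smooth_lagrangian_path ?W ?\<Omega> 0 1 \<Lambda>" "regular_crossings ?W ?\<Omega> 0 1 \<Lambda> ?L"
    "\<Lambda> 0 = shear_line 0" "\<Lambda> 1 = shear_line 1"
    using representative_exists[OF smooth_shear_line regular_shear_line continuous_map_shear_line] .
  let ?B = "velocity_form ?W ?\<Omega> 0 1 \<Lambda> 0"
  have int0: "\<Lambda> 0 \<inter> ?L = span {vec2 0 1}" and int1: "\<Lambda> 1 \<inter> ?L = {0}"
    using shear_line_Int_vertical[of 0] shear_line_Int_vertical[of 1] by (simp_all add: \<Lambda>)
  have scale: "?B (c *\<^sub>R v) (d *\<^sub>R vec2 0 1) = c * d * ?B v (vec2 0 1)" for c d v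
    by (rule velocity_form_scale_plane[OF \<Lambda>(2)]) (simp add: \<Lambda>(4) vec2_01_in_shear_line_0)
  have e: "vec2 0 1 \<in> span {vec2 0 1}"
    by (simp add: span_base)
  have "crossing \<Lambda> ?L 0"
    unfolding crossing_def int0 using e by (metis singletonD vec2_eq_0_iff zero_neq_one)
  then have nondeg: "nondegenerate_on (span {vec2 0 1}) ?B"
    using \<Lambda>(3) by (auto simp: regular_crossings_def int0[simplified])
  \<comment> \<open>The representative need not have the velocity of \<open>shear_line\<close> at 0.
    Its own regularity is what makes the form nonzero, of unknown sign.\<close>
  have B1: "?B (vec2 0 1) (vec2 0 1) \<noteq> 0"
  proof
    assume B0: "?B (vec2 0 1) (vec2 0 1) = 0"
    have "?B (vec2 0 1) w = 0" if w: "w \<in> span {vec2 0 1}" for w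
    proof -
      obtain d where d: "w = d *\<^sub>R vec2 0 1"
        using w unfolding span_singleton by blast
      then show ?thesis
        using scale[of 1 "vec2 0 1" d] B0 by (simp only: d scaleR_one mult_zero_right)
    qed
    then have "vec2 0 1 = 0"
      using nondeg e unfolding nondegenerate_on_def by blast
    then show False
      by simp
  qed
  define s where "s = signature (span {vec2 0 1}) ?B"
  have s: "s \<in> {1, -1}"
    unfolding s_def by (intro signature_line scale B1) simp
  \<comment> \<open>All summands are integers, and a sum over an infinite set would be 0 by
    convention, so the sum is an integer in any case.\<close>
  have "(\<Sum>t | 0 < t \<and> t < 1 \<and> crossing \<Lambda> ?L t. crossing_signature ?W ?\<Omega> 0 1 \<Lambda> ?L t) \<in> \<int>"
    unfolding crossing_signature_def by (intro Ints_sum Ints_of_int)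
  then obtain k where
    "(\<Sum>t | 0 < t \<and> t < 1 \<and> crossing \<Lambda> ?L t. crossing_signature ?W ?\<Omega> 0 1 \<Lambda> ?L t) = of_int k"
    by (rule Ints_cases)
  moreover have "crossing_signature ?W ?\<Omega> 0 1 \<Lambda> ?L 0 = of_int s"
    unfolding crossing_signature_def int0 s_def ..
  moreover have "crossing_signature ?W ?\<Omega> 0 1 \<Lambda> ?L 1 = 0"
    unfolding crossing_signature_def int1 signature_zero_space by simp
  moreover have "mu_RS' 1 0 1 shear = rs_index ?W ?\<Omega> 0 1 shear_line ?L"
    by (simp add: mu_RS'_def shear_line_def[abs_def])
  ultimately have eq: "mu_RS' 1 0 1 shear = of_int s / 2 + of_int k"
    unfolding \<Lambda>(1) regular_rs_index_def by simp
  show ?thesis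
  proof
    assume "mu_RS' 1 0 1 shear \<in> \<int>"
    then obtain m :: int where "real_of_int s / 2 + real_of_int k = real_of_int m"
      unfolding eq by (rule Ints_cases)
    then have "real_of_int s = real_of_int (2 * (m - k))"
      by (simp add: field_simps)
    then have "s = 2 * (m - k)"
      by (simp only: of_int_eq_iff)
    then show False
      using s by simp presburger
  qed
qed


section \<open>The graphs\<close>

definition shear_graph :: "real \<Rightarrow> (rseq \<times> rseq) set" where
  "shear_graph t = Gr 1 (shear t)"

lemma shear_graph_eq: "shear_graph t = {(vec2 x y, vec2 (t * y - x) (- y)) | x y. True}"
proof -
  have "shear_graph t = {(v, mat_apply 2 (shear t) v) | v. v \<in> coord_space 2}"
    by (simp add: shear_graph_def Gr_def)
  also have "\<dots> = {(vec2 x y, vec2 (t * y - x) (- y)) | x y. True}"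
    unfolding coord_space_2 by auto
  finally show ?thesis .
qed

lemma Omega_bar_1_vec2 [simp]:
  "Omega_bar 1 (vec2 x y, vec2 z w) (vec2 x' y', vec2 z' w') = - (x * y' - y * x') + (z * w' - w * z')"
  by (simp add: Omega_bar_def)

lemma subspace_shear_graph: "subspace (shear_graph t)"
  unfolding subspace_def shear_graph_eq
  by (auto simp: zero_prod_def vec2_zero algebra_simps)

lemma lagrangian_shear_graph: "lagrangian (coord_space 2 \<times> coord_space 2) (Omega_bar 1) (shear_graph t)"
  unfolding lagrangian_def
proof (intro conjI subspace_shear_graph)
  let ?V = "shear_graph t"
  show "?V \<subseteq> coord_space 2 \<times> coord_space 2"
    by (auto simp: shear_graph_eq coord_space_2)
  \<comment> \<open>For w = ((x, y), (z, u)), orthogonality to these two vectors reads u = -y and z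
    = t y - x, which are the equations of the graph.\<close>
  have V: "(vec2 1 0, vec2 (-1) 0) \<in> ?V" "(vec2 0 1, vec2 t (-1)) \<in> ?V"
    by (auto simp: shear_graph_eq)
  have "w \<in> ?V" if w: "w \<in> coord_space 2 \<times> coord_space 2" and 0: "\<forall>v\<in>?V. Omega_bar 1 v w = 0" for w
  proof -
    obtain x y z u where xyzu: "w = (vec2 x y, vec2 z u)"
      using w by (auto simp: coord_space_2)
    show ?thesis
      using 0[rule_format, OF V(1)] 0[rule_format, OF V(2)] unfolding xyzu Omega_bar_1_vec2
      by (auto simp: shear_graph_eq)
  qed
  moreover have "w \<in> coord_space 2 \<times> coord_space 2 \<and> (\<forall>v\<in>?V. Omega_bar 1 v w = 0)" if "w \<in> ?V" for w
  proof -
    have "Omega_bar 1 v w = 0" if "v \<in> ?V" for v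
      using \<open>w \<in> ?V\<close> that unfolding shear_graph_eq
      by clarify (simp only: Omega_bar_1_vec2, simp add: algebra_simps)
    then show ?thesis
      using that by (auto simp: shear_graph_eq coord_space_2)
  qed
  ultimately show "{w \<in> coord_space 2 \<times> coord_space 2. \<forall>v\<in>?V. Omega_bar 1 v w = 0} = ?V"
    by blast
qed

text \<open>\<open>L \<times> (\<real> \<times> {0})\<close> is a Lagrangian complement of all the graphs at once.\<close>

definition graph_complement :: "(rseq \<times> rseq) set" where
  "graph_complement = {(vec2 0 p, vec2 q 0) | p q. True}"

lemma lagrangian_graph_complement:
  "lagrangian (coord_space 2 \<times> coord_space 2) (Omega_bar 1) graph_complement"
  unfolding lagrangian_def
proof (intro conjI)
  let ?V = graph_complement
  show "subspace ?V"
    unfolding subspace_def graph_complement_def by (auto simp: zero_prod_def vec2_zero)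
  show "?V \<subseteq> coord_space 2 \<times> coord_space 2"
    by (auto simp: graph_complement_def coord_space_2)
  \<comment> \<open>Pairing ((x, y), (z, u)) with these two vectors gives x and u, which vanish
    exactly on the complement.\<close>
  have V: "(vec2 0 1, vec2 0 0) \<in> ?V" "(vec2 0 0, vec2 1 0) \<in> ?V"
    by (auto simp: graph_complement_def)
  have "w \<in> ?V" if w: "w \<in> coord_space 2 \<times> coord_space 2" and 0: "\<forall>v\<in>?V. Omega_bar 1 v w = 0" for w
  proof -
    obtain x y z u where xyzu: "w = (vec2 x y, vec2 z u)"
      using w by (auto simp: coord_space_2)
    show ?thesis
      using 0[rule_format, OF V(1)] 0[rule_format, OF V(2)] unfolding xyzu Omega_bar_1_vec2
      by (auto simp: graph_complement_def)
  qed
  moreover have "w \<in> coord_space 2 \<times> coord_space 2 \<and> (\<forall>v\<in>?V. Omega_bar 1 v w = 0)" if "w \<in> ?V" for w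
  proof -
    have "Omega_bar 1 v w = 0" if "v \<in> ?V" for v
      using \<open>w \<in> ?V\<close> that unfolding graph_complement_def
      by clarify (simp only: Omega_bar_1_vec2)
    then show ?thesis
      using that by (auto simp: graph_complement_def coord_space_2)
  qed
  ultimately show "{w \<in> coord_space 2 \<times> coord_space 2. \<forall>v\<in>?V. Omega_bar 1 v w = 0} = ?V"
    by blast
qed

lemma shear_graph_span: "shear_graph t = span {(vec2 1 0, vec2 (-1) 0), (vec2 0 1, vec2 t (-1))}"
proof -
  have "(vec2 x y, vec2 (t * y - x) (- y)) = x *\<^sub>R (vec2 1 0, vec2 (-1) 0) + y *\<^sub>R (vec2 0 1, vec2 t (-1))" for x y
    by (simp add: algebra_simps)
  then show ?thesis
    unfolding shear_graph_eq span_insert span_singleton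
    by (auto simp: algebra_simps)
qed

lemma continuous_map_shear_graph:
  "continuous_map (top_of_set S) (lagrangian_topology (coord_space 2 \<times> coord_space 2) (Omega_bar 1)) shear_graph"
proof -
  let ?W = "coord_space 2 \<times> coord_space 2"
  \<comment> \<open>A frame of the graph formed by the images of the two standard basis vectors,
    padded with 0. Only the second vector moves, affinely in \<open>t\<close>.\<close>
  define f where "f t i = (if i = 0 then (vec2 1 0, vec2 (-1) 0) else if i = 1 then (vec2 0 1, vec2 t (-1)) else 0)"
    for t and i :: nat
  have img: "f t ` {..<2} = {(vec2 1 0, vec2 (-1) 0), (vec2 0 1, vec2 t (-1))}" for t
    by (auto simp: f_def image_def less_2_cases_iff)
  have "continuous_on S (\<lambda>t. (vec2 0 1, vec2 0 (-1) + t *\<^sub>R vec2 1 0))"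
    by (intro continuous_intros)
  then have "continuous_on S (\<lambda>t. f t i)" for i
    by (cases "i = 0"; cases "i = 1") (simp_all add: f_def)
  then have "continuous_on S f"
    by (rule continuous_on_coordinatewise_then_product)
  moreover have "f t \<in> lagrangian_frames ?W (Omega_bar 1) 2" for t
  proof -
    have "(vec2 1 0, vec2 (-1) 0) \<notin> span {(vec2 0 1, vec2 t (-1))}"
      by (auto simp: span_singleton)
    then have "independent (f t ` {..<2})"
      unfolding img independent_insert by (auto simp: zero_prod_def independent_empty)
    moreover have "inj_on (f t) {..<2}"
      by (auto simp: inj_on_def f_def less_2_cases_iff)
    moreover have "\<forall>i\<ge>2. f t i = 0"
      by (auto simp: f_def)
    moreover have "lagrangian ?W (Omega_bar 1) (span (f t ` {..<2}))"
      unfolding img shear_graph_span[symmetric] by (rule lagrangian_shear_graph)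
    ultimately show ?thesis
      by (simp add: lagrangian_frames_def)
  qed
  ultimately have "continuous_map (top_of_set S) (lagrangian_topology ?W (Omega_bar 1))
      (\<lambda>t. span (f t ` {..<2}))"
    by (intro continuous_map_span_frames) auto
  then show ?thesis
    unfolding img shear_graph_span[symmetric] by simp
qed

lemma smooth_shear_graph:
  "smooth_lagrangian_path (coord_space 2 \<times> coord_space 2) (Omega_bar 1) a b shear_graph"
proof -
  let ?W = "coord_space 2 \<times> coord_space 2"
  have "\<exists>M \<alpha>. smooth_graph_at ?W (Omega_bar 1) a b shear_graph t0 M \<alpha>" for t0
  proof -
    \<comment> \<open>Over a fixed (x, y), only the coordinate t y - x of the graph point depends on
      t. Its change (t - t0) y lies in the second factor of \<open>graph_complement\<close>.\<close>
    define \<alpha> where "\<alpha> t v = (0 :: rseq, vec2 ((t - t0) * Poly_Mapping.lookup (fst v) 1) 0)"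
      for t and v :: "rseq \<times> rseq"
    have "shear_graph t0 \<inter> graph_complement = {0}"
      by (auto simp: shear_graph_eq graph_complement_def zero_prod_def)
    moreover have "\<exists>v m. (vec2 x y, vec2 z w) = v + m \<and> v \<in> shear_graph t0 \<and> m \<in> graph_complement" for x y z w
      \<comment> \<open>The complement has zero first and last coordinates, so these fix the graph
        component: the base point must be (x, -w). The remainder is the second witness.\<close>
      by (rule exI[of _ "(vec2 x (- w), vec2 (t0 * (- w) - x) w)"],
          rule exI[of _ "(vec2 0 (y + w), vec2 (z + t0 * w + x) 0)"])
        (auto simp: shear_graph_eq graph_complement_def)
    moreover have "v + m \<in> ?W" if "v \<in> shear_graph t0" "m \<in> graph_complement" for v m
      using that by (auto simp: shear_graph_eq graph_complement_def coord_space_2)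
    ultimately have sum: "direct_sum ?W (shear_graph t0) graph_complement"
      unfolding direct_sum_def by (auto simp: coord_space_2)
    have "(vec2 x y, vec2 (t0 * y - x) (- y)) + \<alpha> t (vec2 x y, vec2 (t0 * y - x) (- y)) =
        (vec2 x y, vec2 (t * y - x) (- y))" for t x y
      by (simp add: \<alpha>_def algebra_simps)
    then have graph: "shear_graph t = {v + \<alpha> t v |v. v \<in> shear_graph t0}" for t
      unfolding shear_graph_eq by (auto, metis)
    have "(\<lambda>t. \<alpha> t v) = (\<lambda>t. (0, vec2 (- (t0 * Poly_Mapping.lookup (fst v) 1)) 0)
        + t *\<^sub>R (0, vec2 (Poly_Mapping.lookup (fst v) 1) 0))" for v
      by (simp add: \<alpha>_def algebra_simps)
    then have smooth: "smooth_on S (\<lambda>t. \<alpha> t v)" for S v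
      by (simp only: smooth_on_affine)
    have "\<alpha> t v \<in> graph_complement" for t v
      by (auto simp: \<alpha>_def graph_complement_def vec2_zero)
    moreover have "\<alpha> t (u + v) = \<alpha> t u + \<alpha> t v" "\<alpha> t (c *\<^sub>R v) = c *\<^sub>R \<alpha> t v" for t u v c
      by (simp_all add: \<alpha>_def lookup_add lookup_scaleR algebra_simps)
    ultimately have "smooth_graph_at ?W (Omega_bar 1) a b shear_graph t0 graph_complement \<alpha>"
      by (intro smooth_graph_atI lagrangian_graph_complement sum graph smooth) simp_all
    then show ?thesis
      by blast
  qed
  then show ?thesis
    using lagrangian_shear_graph unfolding smooth_lagrangian_path_def by blast
qed

lemma shear_graph_Int_diagonal: "shear_graph t \<inter> diagonal 1 = {0}"
  by (auto simp: shear_graph_eq diagonal_def coord_space_2 zero_prod_def vec2_zero)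

text \<open>Without crossings the path is vacuously regular. The representative may cross in the
  interior, where it contributes integers, but not at the ends, which it shares with
  \<open>shear_graph\<close>.\<close>

lemma mu_RS_shear: "mu_RS 1 0 1 shear \<in> \<int>"
proof -
  let ?W = "coord_space 2 \<times> coord_space 2" and ?\<Omega> = "Omega_bar 1" and ?L = "diagonal 1"
  have "regular_crossings ?W ?\<Omega> 0 1 shear_graph ?L"
    using shear_graph_Int_diagonal unfolding regular_crossings_def crossing_def by blast
  then obtain \<Lambda> where \<Lambda>: "rs_index ?W ?\<Omega> 0 1 shear_graph ?L = regular_rs_index ?W ?\<Omega> 0 1 \<Lambda> ?L"
    "\<Lambda> 0 = shear_graph 0" "\<Lambda> 1 = shear_graph 1"
    using representative_exists[OF smooth_shear_graph _ continuous_map_shear_graph] by metis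
  have "crossing_signature ?W ?\<Omega> 0 1 \<Lambda> ?L 0 = 0" "crossing_signature ?W ?\<Omega> 0 1 \<Lambda> ?L 1 = 0"
    unfolding crossing_signature_def \<Lambda> shear_graph_Int_diagonal by (simp_all add: signature_zero_space)
  moreover have "(\<Sum>t | 0 < t \<and> t < 1 \<and> crossing \<Lambda> ?L t. crossing_signature ?W ?\<Omega> 0 1 \<Lambda> ?L t) \<in> \<int>"
    unfolding crossing_signature_def by (intro Ints_sum Ints_of_int)
  ultimately have "rs_index ?W ?\<Omega> 0 1 shear_graph ?L \<in> \<int>"
    unfolding \<Lambda>(1) regular_rs_index_def by simp
  then show ?thesis
    by (simp add: mu_RS_def shear_graph_def[abs_def])
qed

theorem mainTheorem4:
  shows "\<exists>n\<ge>1. \<exists>\<psi> :: real \<Rightarrow> nat \<Rightarrow> nat \<Rightarrow> real.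
    continuous_on {0..1} \<psi> \<and> \<psi> ` {0..1} \<subseteq> Sp n \<and> mu_RS n 0 1 \<psi> \<noteq> mu_RS' n 0 1 \<psi>"
proof (intro exI conjI)
  show "shear ` {0..1} \<subseteq> Sp 1"
    using shear_in_Sp by blast
  show "mu_RS 1 0 1 shear \<noteq> mu_RS' 1 0 1 shear"
    using mu_RS_shear mu_RS'_shear by metis
qed (simp_all add: continuous_on_shear)

end
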